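(* There exists a normalized binary goods instance with $n=113$ agents and $m=341$ goods, in which every agent approves exactly $k=165$ goods (i.e. $|\{g\in M: v_i(g)=1\}|=165$ for every agent $i$), such that no complete allocation of the goods is both EF1 and EQ1.
   Context: An instance consists of agents $N=\{1,\dots,n\}$, a finite set $M$ of $m$ indivisible items, and for each agent $i$ an additive valuation $v_i:2^M\to\mathbb{R}$, i.e. $v_i(\emptyset)=0$ and $v_i(S)=\sum_{o\in S}v_i(o)$ for $S\subseteq M$. It is a binary goods instance if $v_i(o)\in\{0,1\}$ for all $i\in N$, $o\in M$; agent $i$ approves $o$ if $v_i(o)=1$. It is normalized if $v_i(M)=v_j(M)$ for all $i,j\in N$. A (complete) allocation $A=(A_1,\dots,A_n)$ is a family of pairwise disjoint, possibly empty subsets of $M$ with $\bigcup_i A_i=M$. Goods may be given to agents who value them at $0$. For goods: $A$ is EF1 if for all $i,j\in N$ with $A_j\neq\emptyset$ there is $g\in A_j$ with $v_i(A_i)\ge v_i(A_j\setminus\{g\})$. $A$ is EQ1 if for all $i,j\in N$ with $A_j\neq\emptyset$ there is $g\in A_j$ with $v_i(A_i)\ge v_j(A_j\setminus\{g\})$. *)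

theory Defs
  imports Complex_Main "HOL-Library.Disjoint_Sets"
begin

definition agents :: "nat \<Rightarrow> nat set" where
  "agents n = {1..n}"

definition additive_valuation :: "'a set \<Rightarrow> ('a set \<Rightarrow> real) \<Rightarrow> bool" where
  "additive_valuation M u \<longleftrightarrow>
     u {} = 0 \<and> (\<forall>S\<subseteq>M. u S = (\<Sum>g\<in>S. u {g}))"

text \<open>In all of the following, \<open>v i S\<close> is the value of agent \<open>i\<close> for the bundle \<open>S\<close>; the value
  written \<open>v\<^sub>i(g)\<close> for a single item is \<open>v i {g}\<close>. Values of \<open>v i S\<close> with \<open>i\<close> not an agent or
  \<open>S\<close> not a subset of the item set are unconstrained and play no role.\<close>

definition fair_instance :: "nat \<Rightarrow> 'a set \<Rightarrow> (nat \<Rightarrow> 'a set \<Rightarrow> real) \<Rightarrow> bool" where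
  "fair_instance n M v \<longleftrightarrow>
     finite M \<and> (\<forall>i\<in>agents n. additive_valuation M (v i))"

definition binary_goods_instance :: "nat \<Rightarrow> 'a set \<Rightarrow> (nat \<Rightarrow> 'a set \<Rightarrow> real) \<Rightarrow> bool" where
  "binary_goods_instance n M v \<longleftrightarrow>
     fair_instance n M v \<and> (\<forall>i\<in>agents n. \<forall>g\<in>M. v i {g} \<in> {0, 1})"

definition normalized :: "nat \<Rightarrow> 'a set \<Rightarrow> (nat \<Rightarrow> 'a set \<Rightarrow> real) \<Rightarrow> bool" where
  "normalized n M v \<longleftrightarrow> (\<forall>i\<in>agents n. \<forall>j\<in>agents n. v i M = v j M)"

definition approved :: "'a set \<Rightarrow> (nat \<Rightarrow> 'a set \<Rightarrow> real) \<Rightarrow> nat \<Rightarrow> 'a set" where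
  "approved M v i = {g \<in> M. v i {g} = 1}"

definition complete_allocation :: "nat \<Rightarrow> 'a set \<Rightarrow> (nat \<Rightarrow> 'a set) \<Rightarrow> bool" where
  "complete_allocation n M A \<longleftrightarrow>
     disjoint_family_on A (agents n) \<and> (\<Union>i\<in>agents n. A i) = M"

definition EF1 :: "nat \<Rightarrow> (nat \<Rightarrow> 'a set \<Rightarrow> real) \<Rightarrow> (nat \<Rightarrow> 'a set) \<Rightarrow> bool" where
  "EF1 n v A \<longleftrightarrow>
     (\<forall>i\<in>agents n. \<forall>j\<in>agents n. A j \<noteq> {} \<longrightarrow>
        (\<exists>g\<in>A j. v i (A i) \<ge> v i (A j - {g})))"

definition EQ1 :: "nat \<Rightarrow> (nat \<Rightarrow> 'a set \<Rightarrow> real) \<Rightarrow> (nat \<Rightarrow> 'a set) \<Rightarrow> bool" where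
  "EQ1 n v A \<longleftrightarrow>
     (\<forall>i\<in>agents n. \<forall>j\<in>agents n. A j \<noteq> {} \<longrightarrow>
        (\<exists>g\<in>A j. v i (A i) \<ge> v j (A j - {g})))"

end

theory Submission
  imports Defs
begin

text \<open>The goods are the \<open>31\<close> points of the projective space \<open>PG(4,2)\<close>, each in \<open>11\<close> copies, and the
  approval sets are its \<open>31\<close> hyperplanes, one of which is shared by \<open>83\<close> agents. As \<open>2 * 83 > 165\<close>,
  one of these agents has value at most \<open>1\<close>, so by EQ1 nobody has value above \<open>2\<close>. As
  \<open>341 > 3 * 113\<close>, some bundle has four goods; any four points lie in a common hyperplane, and an
  agent approving that hyperplane violates EF1.\<close>

text \<open>Numbers below \<open>32\<close> encode vectors of \<open>GF(2)\<^sup>5\<close> by their bits.\<close>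

definition orthogonal_bits :: "nat \<Rightarrow> nat \<Rightarrow> bool" where
  "orthogonal_bits x y \<longleftrightarrow> even (\<Sum>b<5. of_bool (bit x b \<and> bit y b) :: nat)"

text \<open>This is linearity of the dot product over GF(2) in its first argument, as
  \<open>xor\<close> is vector addition. The bound 5 is generalized to \<open>n\<close> for the
  induction.\<close>

lemma orthogonal_bits_xor:
  "orthogonal_bits (xor x y) z \<longleftrightarrow> (orthogonal_bits x z \<longleftrightarrow> orthogonal_bits y z)"
proof -
  have "even (\<Sum>b<n. of_bool (bit (xor x y) b \<and> bit z b) :: nat) \<longleftrightarrow>
    (even (\<Sum>b<n. of_bool (bit x b \<and> bit z b) :: nat) \<longleftrightarrow>
     even (\<Sum>b<n. of_bool (bit y b \<and> bit z b) :: nat))" for n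
    by (induction n) (auto simp: bit_xor_iff)
  then show ?thesis
    by (simp add: orthogonal_bits_def)
qed

text \<open>Four linear conditions on a space of dimension five have a nonzero solution. Concretely,
  32 vectors yield at most 16 orthogonality patterns, and the sum of two distinct vectors with equal
  patterns is orthogonal to all four points.\<close>

lemma ex_orthogonal_to_four:
  "\<exists>h\<in>{1..31}. \<forall>p\<in>set [a, b, c, d]. orthogonal_bits h p"
proof -
  define f where "f h = map (orthogonal_bits h) [a, b, c, d]" for h
  have "f ` {..<32} \<subseteq> {xs. set xs \<subseteq> UNIV \<and> length xs = 4}"
    by (auto simp: f_def)
  then have "card (f ` {..<32}) \<le> card {xs :: bool list. set xs \<subseteq> UNIV \<and> length xs = 4}"
    by (intro card_mono finite_lists_length_eq) auto
  also have "\<dots> = 2 ^ 4"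
    by (subst card_lists_length_eq) auto
  finally have "card (f ` {..<32}) < card {..<32 :: nat}"
    by simp
  then have "\<not> inj_on f {..<32}"
    by (rule pigeonhole)
  then obtain x y where xy: "x < 32" "y < 32" "x \<noteq> y" "f x = f y"
    by (auto simp: inj_on_def)
  have "xor x y \<noteq> 0"
    using \<open>x \<noteq> y\<close> by (metis xor.assoc xor.right_neutral xor_self_eq)
  \<comment> \<open>Both arguments fit in five bits, and \<open>xor\<close> sets no further
    bit.\<close>
  moreover have "xor x y < 32"
    using xy take_bit_nat_less_exp[of 5 "xor x y"] by (simp add: take_bit_nat_eq_self)
  ultimately have "xor x y \<in> {1..31}"
    by auto
  then show ?thesis
    using xy(4) by (intro bexI[of _ "xor x y"]) (auto simp: f_def orthogonal_bits_xor)
qed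

text \<open>Good \<open>g\<close> is copy \<open>g div 31\<close> of the point
  \<open>g mod 31 + 1\<close>. The shift by one skips the zero vector, which is not a projective
  point.\<close>

definition hyperplane_goods :: "nat \<Rightarrow> nat set" where
  "hyperplane_goods h = {g \<in> {..<341}. orthogonal_bits h (g mod 31 + 1)}"

text \<open>A nonzero \<open>h\<close> is orthogonal to 16 vectors, 15 of them nonzero. The form
  with lists lets all 31 cases be settled by evaluation.\<close>

lemma card_hyperplane:
  "\<forall>h\<in>set [1..<32]. length (filter (\<lambda>p. orthogonal_bits h (p + 1)) [0..<31]) = 15"
  unfolding orthogonal_bits_def
  by code_simp

lemma card_hyperplane_goods:
  assumes "h \<in> {1..31}"
  shows "card (hyperplane_goods h) = 165"
proof -
  let ?P = "{p\<in>{..<31}. orthogonal_bits h (p + 1)}"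
  have "?P = set (filter (\<lambda>p. orthogonal_bits h (p + 1)) [0..<31])"
    by auto
  then have P: "card ?P = 15"
    using card_hyperplane assms by (simp only: distinct_card distinct_filter distinct_upt) auto
  \<comment> \<open>Division with remainder splits a good into its point and its copy number, giving
    15 * 11 = 165.\<close>
  have "bij_betw (\<lambda>g. (g mod 31, g div 31)) (hyperplane_goods h) (?P \<times> {..<11})"
    by (rule bij_betwI[where g = "\<lambda>(p, c). 31 * c + p"])
      (auto simp: hyperplane_goods_def)
  then show ?thesis
    using P by (simp add: bij_betw_same_card card_cartesian_product)
qed

text \<open>The four goods may include copies of one point; this is harmless, since
  \<open>ex_orthogonal_to_four\<close> does not ask for distinct points.\<close>

lemma ex_hyperplane_goods_four:
  assumes "B \<subseteq> {..<341}" "card B \<ge> 4"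
  shows "\<exists>h\<in>{1..31}. card (B \<inter> hyperplane_goods h) \<ge> 4"
proof -
  obtain F where F: "F \<subseteq> B" "card F = 4"
    using assms(2) by (meson obtain_subset_with_card_n)
  then obtain a b c d where abcd: "F = {a, b, c, d}"
    by (auto simp: card_Suc_eq eval_nat_numeral)
  obtain h where h: "h \<in> {1..31}"
    "\<forall>p\<in>set (map (\<lambda>g. g mod 31 + 1) [a, b, c, d]). orthogonal_bits h p"
    using ex_orthogonal_to_four by fastforce
  then have "F \<subseteq> B \<inter> hyperplane_goods h"
    using F abcd assms(1) by (auto simp: hyperplane_goods_def)
  moreover have "finite B"
    using assms(1) finite_subset by blast
  ultimately show ?thesis
    using h(1) F(2) card_mono[of "B \<inter> hyperplane_goods h" F] by auto
qed

text \<open>Used to turn the removal of a good in EF1 and EQ1 into a slack of one between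
  cardinalities.\<close>

lemma card_le_Suc_card_Diff_singleton:
  "card (B \<inter> S) \<le> Suc (card ((B - {g}) \<inter> S))"
proof -
  have "(B - {g}) \<inter> S = B \<inter> S - {g}"
    by auto
  then show ?thesis
    by (simp add: card_Diff_singleton_if) linarith
qed

theorem theorem4:
  shows "\<exists>(M :: nat set) (v :: nat \<Rightarrow> nat set \<Rightarrow> real).
    binary_goods_instance 113 M v \<and>
    normalized 113 M v \<and>
    card M = 341 \<and>
    (\<forall>i\<in>agents 113. card (approved M v i) = 165) \<and>
    \<not> (\<exists>A. complete_allocation 113 M A \<and> EF1 113 v A \<and> EQ1 113 v A)"
proof -
  define M where "M = {..<341 :: nat}"
  \<comment> \<open>Agents 1 to 30 get one hyperplane each, and agents 31 to 113 share the last one,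
    so every hyperplane \<open>h\<close> is approved by agent \<open>h\<close>.\<close>
  define S where "S i = hyperplane_goods (min i 31)" for i
  define v where "v i B = real (card (B \<inter> S i))" for i B
  have S_sub: "S i \<subseteq> M" for i
    by (auto simp: S_def M_def hyperplane_goods_def)
  have card_S: "card (S i) = 165" if "i \<in> agents 113" for i
    using that unfolding S_def agents_def by (intro card_hyperplane_goods) auto
  have v_single: "v i {g} = of_bool (g \<in> S i)" for i g
    by (simp add: v_def)
  have "additive_valuation M (v i)" for i
    unfolding additive_valuation_def v_single
  proof (intro conjI allI impI)
    fix B assume "B \<subseteq> M"
    then have "finite B"
      by (auto simp: M_def intro: finite_subset)
    then show "v i B = (\<Sum>g\<in>B. of_bool (g \<in> S i))"
      by (simp add: v_def Int_def)
  qed (simp add: v_def)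
  then have "binary_goods_instance 113 M v"
    by (auto simp: binary_goods_instance_def fair_instance_def v_single M_def)
  moreover have "normalized 113 M v"
    using S_sub card_S by (simp add: normalized_def v_def Int_absorb1)
  moreover have "card M = 341"
    by (simp add: M_def)
  moreover have "\<forall>i\<in>agents 113. card (approved M v i) = 165"
  proof
    fix i assume "i \<in> agents 113"
    moreover have "approved M v i = S i"
      using S_sub by (auto simp: approved_def v_single)
    ultimately show "card (approved M v i) = 165"
      using card_S by simp
  qed
  moreover have False
    if alloc: "complete_allocation 113 M A" and ef: "EF1 113 v A" and eq: "EQ1 113 v A" for A
  proof -
    have disj: "disjoint_family_on A {1..113}" and un: "(\<Union>i\<in>{1..113}. A i) = M"
      using alloc by (auto simp: complete_allocation_def agents_def)
    have sub: "A i \<subseteq> M" if "i \<in> {1..113}" for i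
      using un that by blast
    then have fin: "finite (A i)" if "i \<in> {1..113}" for i
      using that by (auto simp: M_def intro: finite_subset)
    have envy: "card (A j \<inter> S i) \<le> Suc (card (A i \<inter> S i))"
      if ij: "i \<in> {1..113}" "j \<in> {1..113}" for i j
    proof (cases "A j = {}")
      case False
      then obtain g where "v i (A j - {g}) \<le> v i (A i)"
        using ef ij unfolding EF1_def agents_def by blast
      then show ?thesis
        using card_le_Suc_card_Diff_singleton[of "A j" "S i" g] by (simp add: v_def)
    qed simp
    have equit: "card (A j \<inter> S j) \<le> Suc (card (A i \<inter> S i))"
      if ij: "i \<in> {1..113}" "j \<in> {1..113}" for i j
    proof (cases "A j = {}")
      case False
      then obtain g where "v j (A j - {g}) \<le> v i (A i)"
        using eq ij unfolding EQ1_def agents_def by blast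
      then show ?thesis
        using card_le_Suc_card_Diff_singleton[of "A j" "S j" g] by (simp add: v_def)
    qed simp
    have "\<exists>i\<in>{31..113}. card (A i \<inter> S i) \<le> 1"
    proof (rule ccontr)
      assume small: "\<not> ?thesis"
      have "2 \<le> card (A i \<inter> S 31)" if "i \<in> {31..113}" for i
      proof -
        have "S i = S 31"
          using that by (simp add: S_def min_absorb2)
        moreover have "\<not> card (A i \<inter> S i) \<le> 1"
          using small that by blast
        ultimately show ?thesis
          by simp
      qed
      \<comment> \<open>The left side is 166, one more than the shared hyperplane can supply to
        disjoint bundles.\<close>
      then have "(\<Sum>i\<in>{31..113::nat}. 2) \<le> (\<Sum>i\<in>{31..113}. card (A i \<inter> S 31))"
        by (rule sum_mono)
      also have "\<dots> = card (\<Union>i\<in>{31..113}. A i \<inter> S 31)"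
      proof (rule card_UN_disjoint[symmetric])
        have "disjoint_family_on A {31..113}"
          using disj by (rule disjoint_family_on_mono[rotated]) auto
        then show "\<forall>i\<in>{31..113}. \<forall>j\<in>{31..113}. i \<noteq> j \<longrightarrow> A i \<inter> S 31 \<inter> (A j \<inter> S 31) = {}"
          unfolding disjoint_family_on_def by blast
      qed (use fin in auto)
      also have "\<dots> \<le> card (S 31)"
        using S_sub[of 31] by (intro card_mono) (auto simp: M_def intro: finite_subset)
      also have "\<dots> = 165"
        by (rule card_S) (simp add: agents_def)
      finally show False
        by simp
    qed
    then obtain i where "i \<in> {31..113}" "card (A i \<inter> S i) \<le> 1"
      by blast
    then have i: "i \<in> {1..113}" "card (A i \<inter> S i) \<le> 1"
      by auto
    have le2: "card (A j \<inter> S j) \<le> 2" if "j \<in> {1..113}" for j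
      using equit[OF i(1) that] i(2) by simp
    have "\<exists>j\<in>{1..113}. 4 \<le> card (A j)"
    proof (rule ccontr)
      assume small: "\<not> ?thesis"
      have "card (A j) \<le> 3" if "j \<in> {1..113}" for j
      proof -
        have "\<not> 4 \<le> card (A j)"
          using small that by blast
        then show ?thesis
          by simp
      qed
      then have "(\<Sum>j\<in>{1..113}. card (A j)) \<le> (\<Sum>j\<in>{1..113::nat}. 3)"
        by (rule sum_mono)
      moreover have "card M = (\<Sum>j\<in>{1..113}. card (A j))"
        unfolding un[symmetric] using disj fin
        by (subst card_UN_disjoint) (auto simp: disjoint_family_on_def)
      ultimately show False
        by (simp add: M_def)
    qed
    then obtain j where j: "j \<in> {1..113}" "4 \<le> card (A j)"
      by blast
    then obtain h where h: "h \<in> {1..31}" "4 \<le> card (A j \<inter> hyperplane_goods h)"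
      using ex_hyperplane_goods_four sub unfolding M_def by meson
    then have "4 \<le> card (A j \<inter> S h)" "h \<in> {1..113}"
      by (auto simp: S_def)
    \<comment> \<open>Agent \<open>h\<close> sees at least 4 in \<open>A j\<close>, so EF1 requires
      an own value of at least 3, but EQ1 has capped it at 2.\<close>
    with envy[of h j] le2[of h] j(1) show False
      by simp
  qed
  ultimately show ?thesis
    by blast
qed

end
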